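(* For every integer $n\ge0$, every $i\in\{0,2\}$ and every $j\in\{0,1,2,3,4\}$, the number of partitions $\pi$ of $5n+4$ with $\mathrm{srank}(\pi)\equiv i\pmod4$ and $c_5(\pi)\equiv j\pmod 5$ equals $\tfrac15 p_i(5n+4)$.
   Context: For a partition $\pi$, $\pi'$ is its conjugate, $\mathcal O(\pi)$ the number of odd parts, $\mathrm{srank}(\pi)=\mathcal O(\pi)-\mathcal O(\pi')$, and $p_i(n)$ ($i=0,2$) the number of partitions of $n$ with $\mathrm{srank}\equiv i\pmod4$. A $t$-core is a partition with no rim hook (border strip) of length $t$; the $t$-core of $\pi$ is the $t$-core obtained by successively removing rim hooks of length $t$ from $\pi$ as long as possible. In the Young diagram, the cell in row $a$ and column $b$ is labelled by the residue of $b-a$ modulo $t$. For a $t$-core $\kappa$, let $r_i$ ($0\le i\le t-1$) be the number of cells of $\kappa$ labelled $i$; its $n$-vector is $(n_0,\dots,n_{t-1})=(r_0-r_1,r_1-r_2,\dots,r_{t-2}-r_{t-1},r_{t-1}-r_0)$. 5-core crank: for a partition $\pi$ with $|\pi|\equiv4\pmod5$, let $(n_0,\dots,n_4)$ be the $n$-vector of the 5-core of $\pi$; then $c_5(\pi)$ is defined modulo $5$ by $c_5(\pi)\equiv 2(1+n_0-n_1-n_2+n_3)\pmod 5$. *)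

theory Defs
  imports Complex_Main
begin

text \<open>Partitions are represented as lists of positive naturals in nonincreasing order.\<close>

definition is_partition :: "nat list \<Rightarrow> bool" where
  "is_partition p \<longleftrightarrow> sorted_wrt (\<ge>) p \<and> 0 \<notin> set p"

definition partitions :: "nat \<Rightarrow> nat list set" where
  "partitions m = {p. is_partition p \<and> sum_list p = m}"

text \<open>Conjugate partition: the k-th part (k = 1 .. largest part) counts parts that are at least k.\<close>
definition conj_part :: "nat list \<Rightarrow> nat list" where
  "conj_part p = map (\<lambda>k. length (filter (\<lambda>x. k < x) p))
                     [0..<(if p = [] then 0 else hd p)]"

definition num_odd :: "nat list \<Rightarrow> nat" where
  "num_odd p = length (filter odd p)"

definition srank :: "nat list \<Rightarrow> int" where
  "srank p = int (num_odd p) - int (num_odd (conj_part p))"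

definition p_srank :: "int \<Rightarrow> nat \<Rightarrow> nat" where
  "p_srank i m = card {p \<in> partitions m. srank p mod 4 = i}"

text \<open>Young diagram, 0-indexed: cell (a,b) lies in row a, column b.\<close>
definition diagram :: "nat list \<Rightarrow> (nat \<times> nat) set" where
  "diagram p = {(a, b). a < length p \<and> b < p ! a}"

definition cell_adj :: "nat \<times> nat \<Rightarrow> nat \<times> nat \<Rightarrow> bool" where
  "cell_adj u v \<longleftrightarrow>
     (fst u = fst v \<and> (snd u = snd v + 1 \<or> snd v = snd u + 1)) \<or>
     (snd u = snd v \<and> (fst u = fst v + 1 \<or> fst v = fst u + 1))"

definition cells_connected :: "(nat \<times> nat) set \<Rightarrow> bool" where
  "cells_connected S \<longleftrightarrow>
     (\<forall>x\<in>S. \<forall>y\<in>S. (x, y) \<in> {(u, v). u \<in> S \<and> v \<in> S \<and> cell_adj u v}\<^sup>*)"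

definition no_2x2 :: "(nat \<times> nat) set \<Rightarrow> bool" where
  "no_2x2 S \<longleftrightarrow> \<not> (\<exists>a b. {(a, b), (a + 1, b), (a, b + 1), (a + 1, b + 1)} \<subseteq> S)"

text \<open>q is obtained from p by removing a rim hook (border strip) of length t:
  the skew shape p/q is a connected set of t cells containing no 2x2 square.\<close>
definition remove_hook :: "nat \<Rightarrow> nat list \<Rightarrow> nat list \<Rightarrow> bool" where
  "remove_hook t p q \<longleftrightarrow>
     is_partition p \<and> is_partition q \<and> diagram q \<subseteq> diagram p \<and>
     card (diagram p - diagram q) = t \<and>
     cells_connected (diagram p - diagram q) \<and> no_2x2 (diagram p - diagram q)"

definition is_core :: "nat \<Rightarrow> nat list \<Rightarrow> bool" where
  "is_core t k \<longleftrightarrow> is_partition k \<and> \<not> (\<exists>q. remove_hook t k q)"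

text \<open>The t-core: the t-core reached by successively removing rim hooks of length t.\<close>
definition core :: "nat \<Rightarrow> nat list \<Rightarrow> nat list" where
  "core t p = (THE k. is_core t k \<and> (remove_hook t)\<^sup>*\<^sup>* p k)"

definition res_count :: "nat \<Rightarrow> nat list \<Rightarrow> nat \<Rightarrow> int" where
  "res_count t k i = int (card {(a, b) \<in> diagram k. (int b - int a) mod int t = int i})"

text \<open>n-vector: n_i = r_i - r_{i+1}, indices mod t.\<close>
definition nvec :: "nat \<Rightarrow> nat list \<Rightarrow> nat \<Rightarrow> int" where
  "nvec t k i = res_count t k i - res_count t k ((i + 1) mod t)"

definition crank5 :: "nat list \<Rightarrow> int" where
  "crank5 p = (let n = nvec 5 (core 5 p) in
               (2 * (1 + n 0 - n 1 - n 2 + n 3)) mod 5)"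

end

theory Submission
  imports Defs
begin

text \<open>
  A partition is encoded by its bead set \<open>{p_a - a - 1}\<close>. The \<open>i\<close>-th entry \<open>n_i\<close> of its \<open>n\<close>-vector modulo \<open>t\<close>
  is the number of beads congruent to \<open>i\<close>, counted relative to the empty partition. A rim hook of length
  \<open>t\<close> meets each residue once, so a partition and its \<open>t\<close>-core have the same \<open>n\<close>-vector. Counting cells
  of the diagram by colour on a chessboard shows that \<open>srank\<close> modulo 4 is determined by the size and by
  the \<open>n\<close>-vector modulo 2, that is, by the excess of even beads.

  For size \<open>4\<close> modulo \<open>5\<close>, Garvan, Kim and Stanton parametrise the \<open>n\<close>-vectors modulo 5 by integers
  \<open>a_0, ..., a_4\<close> with sum 1 such that rotating the \<open>a_i\<close> preserves the size of the 5-core and raises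
  the 5-core crank by one. The rotation also preserves the number of odd entries among the runner ends
  \<open>5 n_i + i\<close>. Hence the runners of the abacus can be matched so that the rotated \<open>n\<close>-vector is reached by
  moving each runner rigidly by an even distance. This moves beads without changing their parity, so it
  preserves both the size and \<open>srank\<close> modulo 4. It is injective and advances the crank cyclically.
\<close>

subsection \<open>Relative sums over commensurable sets\<close>

definition commensurable :: "'a set \<Rightarrow> 'a set \<Rightarrow> bool" where
  "commensurable A B \<longleftrightarrow> finite (A - B) \<and> finite (B - A)"

text \<open>For infinite \<open>A\<close> and \<open>B\<close> this regularises the difference of
  the sums of \<open>K\<close> over \<open>A\<close> and over \<open>B\<close>; commensurability
  makes both set differences finite.\<close>

definition excess :: "('a \<Rightarrow> int) \<Rightarrow> 'a set \<Rightarrow> 'a set \<Rightarrow> int" where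
  "excess K A B = sum K (A - B) - sum K (B - A)"

lemma commensurable_sym: "commensurable A B \<Longrightarrow> commensurable B A"
  by (auto simp: commensurable_def)

lemma commensurable_trans:
  assumes "commensurable A B" "commensurable B C"
  shows "commensurable A C"
proof -
  have "A - C \<subseteq> (A - B) \<union> (B - C)" "C - A \<subseteq> (C - B) \<union> (B - A)" by auto
  with assms show ?thesis
    unfolding commensurable_def by (meson finite_UnI finite_subset)
qed

lemma commensurable_image:
  assumes "inj f" "commensurable A B"
  shows "commensurable (f ` A) (f ` B)"
  using assms by (simp add: commensurable_def image_set_diff[symmetric])

lemma excess_eq_sum:
  assumes "finite U" "A - B \<subseteq> U" "B - A \<subseteq> U"
  shows "excess K A B = (\<Sum>x\<in>U. K x * (of_bool (x \<in> A) - of_bool (x \<in> B)))"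
proof -
  have "sum K (A - B) = (\<Sum>x\<in>U. if x \<in> A - B then K x else 0)"
    by (rule sum.mono_neutral_cong_left) (use assms in auto)
  moreover have "sum K (B - A) = (\<Sum>x\<in>U. if x \<in> B - A then K x else 0)"
    by (rule sum.mono_neutral_cong_left) (use assms in auto)
  ultimately have "excess K A B =
      (\<Sum>x\<in>U. (if x \<in> A - B then K x else 0) - (if x \<in> B - A then K x else 0))"
    by (simp add: excess_def sum_subtractf)
  also have "\<dots> = (\<Sum>x\<in>U. K x * (of_bool (x \<in> A) - of_bool (x \<in> B)))"
    by (rule sum.cong) auto
  finally show ?thesis .
qed

lemma excess_trans:
  assumes "commensurable A B" "commensurable B C"
  shows "excess K A B + excess K B C = excess K A C"
proof -
  define U where "U = (A - B) \<union> (B - A) \<union> (B - C) \<union> (C - B)"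
  have U: "finite U" using assms by (simp add: U_def commensurable_def)
  have "excess K A B = (\<Sum>x\<in>U. K x * (of_bool (x \<in> A) - of_bool (x \<in> B)))"
    "excess K B C = (\<Sum>x\<in>U. K x * (of_bool (x \<in> B) - of_bool (x \<in> C)))"
    "excess K A C = (\<Sum>x\<in>U. K x * (of_bool (x \<in> A) - of_bool (x \<in> C)))"
    by (rule excess_eq_sum[OF U]; auto simp: U_def)+
  thus ?thesis by (simp add: sum.distrib[symmetric] algebra_simps)
qed

lemma excess_swap: "excess K A B = - excess K B A"
  by (simp add: excess_def)

lemma excess_image:
  assumes "inj f"
  shows "excess K (f ` A) (f ` B) = excess (K \<circ> f) A B"
  using assms
  by (simp add: excess_def image_set_diff[symmetric] sum.reindex inj_on_subset[OF assms])

lemma excess_add: "excess (\<lambda>x. K x + L x) A B = excess K A B + excess L A B"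
  by (simp add: excess_def sum.distrib)

lemma excess_diff: "excess (\<lambda>x. K x - L x) A B = excess K A B - excess L A B"
  by (simp add: excess_def sum_subtractf)

lemma excess_mult: "excess (\<lambda>x. c * K x) A B = c * excess K A B"
  by (simp add: excess_def sum_distrib_left algebra_simps)

lemma excess_sum: "excess (\<lambda>x. \<Sum>i\<in>I. K i x) A B = (\<Sum>i\<in>I. excess (K i) A B)"
proof -
  have "(\<Sum>x\<in>C. \<Sum>i\<in>I. K i x) = (\<Sum>i\<in>I. sum (K i) C)" for C
    by (rule sum.swap)
  thus ?thesis by (simp add: excess_def sum_subtractf)
qed

section \<open>Affine permutations and the relative sums of their images\<close>

locale affine_permutation =
  fixes t :: int and \<phi> :: "int \<Rightarrow> int"
  assumes t_pos: "t > 0" and bij: "bij \<phi>" and shift: "\<phi> (x + t) = \<phi> x + t"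
begin

lemma shift_mult: "\<phi> (x + t * k) = \<phi> x + t * k"
proof (induction k rule: int_induct[where k = 0])
  case (step1 i)
  thus ?case using shift[of "x + t * i"] by (simp add: algebra_simps)
next
  case (step2 i)
  thus ?case using shift[of "x + t * (i - 1)"] by (simp add: algebra_simps)
qed simp

lemma eq_mod: "\<phi> x = x + (\<phi> (x mod t) - x mod t)"
  using shift_mult[of "x mod t" "x div t"] by (simp add: algebra_simps)

text \<open>The displacement \<open>\<phi> x - x\<close> depends only on \<open>x mod t\<close>,
  hence is bounded by some \<open>D\<close>; only integers within distance \<open>D\<close> of 0 can
  cross 0.\<close>

lemma commensurable_image_negative: "commensurable (\<phi> ` {..<0}) {..<0}"
proof -
  obtain D where D: "\<And>i. i \<in> {0..<t} \<Longrightarrow> \<bar>\<phi> i - i\<bar> \<le> D"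
  proof -
    have "\<bar>\<phi> i - i\<bar> \<le> (\<Sum>i\<in>{0..<t}. \<bar>\<phi> i - i\<bar>)" if "i \<in> {0..<t}" for i
      using member_le_sum[OF that, of "\<lambda>i. \<bar>\<phi> i - i\<bar>"] by simp
    thus ?thesis using that by blast
  qed
  have D: "\<bar>\<phi> x - x\<bar> \<le> D" for x
    using D[of "x mod t"] eq_mod[of x] t_pos by simp
  have "\<phi> ` {..<0} - {..<0} \<subseteq> {0..D}"
  proof
    fix y assume "y \<in> \<phi> ` {..<0} - {..<0}"
    then obtain x where "y = \<phi> x" "x < 0" "y \<ge> 0" by auto
    with D[of x] show "y \<in> {0..D}" by auto
  qed
  moreover have "{..<0} - \<phi> ` {..<0} \<subseteq> {- D..0}"
  proof
    fix y assume y: "y \<in> {..<0} - \<phi> ` {..<0}"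
    obtain x where x: "y = \<phi> x" using bij by (metis bij_pointE)
    with y have "x \<ge> 0" by force
    with D[of x] x y show "y \<in> {- D..0}" by auto
  qed
  ultimately show ?thesis
    unfolding commensurable_def by (meson finite_atLeastAtMost_int finite_subset)
qed

text \<open>\<open>L\<close> is a discrete antiderivative of \<open>c * K\<close> for the
  translation by \<open>t\<close>. As that translation commutes with \<open>\<phi>\<close>, the sum
  telescopes: only the window \<open>{0..<t}\<close>, by which \<open>{..<0}\<close> and its
  translate differ, and the image of this window survive.\<close>

lemma excess_image_negative:
  assumes L: "\<And>x. L (x + t) = L x + c * K x"
  shows "c * excess K (\<phi> ` {..<0}) {..<0} = (\<Sum>i\<in>{0..<t}. L (\<phi> i) - L i)"
proof -
  define \<psi> where "\<psi> = (\<lambda>x::int. x + t)"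
  define N where "N = {..<0::int}"
  have \<psi>: "inj \<psi>" by (simp add: \<psi>_def)
  have \<phi>: "inj \<phi>" using bij by (simp add: bij_def)
  have \<psi>N: "\<psi> ` N = {..<t}"
  proof
    show "{..<t} \<subseteq> \<psi> ` N"
      by (auto simp: \<psi>_def N_def image_iff intro!: bexI[of _ "_ - t"])
  qed (auto simp: \<psi>_def N_def)
  have d: "\<psi> ` N - N = {0..<t}" "N - \<psi> ` N = {}"
    using t_pos unfolding \<psi>N by (auto simp: N_def)
  have c1: "commensurable (\<phi> ` N) N"
    using commensurable_image_negative by (simp add: N_def)
  have c2: "commensurable (\<psi> ` N) N" by (simp add: commensurable_def d)
  have comm: "\<psi> ` \<phi> ` N = \<phi> ` \<psi> ` N"
    by (simp add: image_image \<psi>_def shift)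
  have c3: "commensurable (\<phi> ` \<psi> ` N) (\<phi> ` N)"
    by (rule commensurable_image[OF \<phi> c2])
  have "c * excess K (\<phi> ` N) N = excess (\<lambda>x. (L \<circ> \<psi>) x - L x) (\<phi> ` N) N"
    by (simp add: excess_mult[symmetric] L \<psi>_def)
  also have "\<dots> = excess L (\<phi> ` \<psi> ` N) (\<psi> ` N) - excess L (\<phi> ` N) N"
    unfolding excess_diff excess_image[OF \<psi>, symmetric] comm[symmetric] by simp
  also have "excess L (\<phi> ` \<psi> ` N) (\<psi> ` N) =
      excess L (\<phi> ` \<psi> ` N) (\<phi> ` N) + excess L (\<phi> ` N) N + excess L N (\<psi> ` N)"
    using excess_trans[OF c3 c1] 
      excess_trans[OF commensurable_trans[OF c3 c1] commensurable_sym[OF c2]] by metis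
  also have "excess L (\<phi> ` \<psi> ` N) (\<phi> ` N) = (\<Sum>i\<in>{0..<t}. L (\<phi> i))"
    by (simp add: excess_image[OF \<phi>]) (simp add: excess_def d)
  also have "excess L N (\<psi> ` N) = - (\<Sum>i\<in>{0..<t}. L i)"
    by (simp add: excess_def d)
  finally show ?thesis by (simp add: N_def sum_subtractf)
qed

text \<open>Substituting \<open>\<phi>\<close> in the weight leaves a correction that depends on
  \<open>\<phi>\<close> and \<open>K\<close> but not on \<open>B\<close>;
  \<open>excess_image_negative\<close> computes it.\<close>

lemma excess_image_commensurable:
  assumes "commensurable B {..<0}"
  shows "excess K (\<phi> ` B) {..<0} = excess (K \<circ> \<phi>) B {..<0} + excess K (\<phi> ` {..<0}) {..<0}"
  using excess_trans[OF commensurable_image[OF bij_is_inj[OF bij] assms] commensurable_image_negative]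
  by (metis excess_image bij bij_is_inj)

end

subsection \<open>Bead sets of partitions\<close>

definition row :: "nat list \<Rightarrow> nat \<Rightarrow> nat" where
  "row p a = (if a < length p then p ! a else 0)"

definition bead :: "nat list \<Rightarrow> nat \<Rightarrow> int" where
  "bead p a = int (row p a) - int a - 1"

text \<open>The Maya diagram, or infinite beta-set. Empty rows contribute all sufficiently negative
  integers, and the empty partition has the bead set \<open>{..<0}\<close>, so relative sums are
  taken against that set.\<close>

definition beads :: "nat list \<Rightarrow> int set" where
  "beads p = range (bead p)"

lemma row_antimono:
  assumes "is_partition p" "a \<le> b"
  shows "row p b \<le> row p a"
  using assms by (cases "a = b") (auto simp: row_def is_partition_def sorted_wrt_iff_nth_less)

lemma row_eq_0_iff: "is_partition p \<Longrightarrow> row p a = 0 \<longleftrightarrow> length p \<le> a"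
  using nth_mem[of a p] by (cases "a < length p"; cases "p ! a = 0") (auto simp: row_def is_partition_def)

lemma row_inject:
  assumes "is_partition p" "is_partition q" "row p = row q"
  shows "p = q"
proof (rule nth_equalityI)
  show "length p = length q"
    using assms by (metis row_eq_0_iff le_antisym order_refl)
  thus "p ! i = q ! i" if "i < length p" for i
    using that fun_cong[OF assms(3), of i] by (simp add: row_def)
qed

lemma partition_of_rows:
  assumes f: "\<And>a b. a \<le> b \<Longrightarrow> f b \<le> f a" and N: "f N = (0::nat)"
  obtains p where "is_partition p" "row p = f"
proof -
  define M where "M = (LEAST n. f n = 0)"
  have M: "f M = 0" unfolding M_def by (rule LeastI[of _ N]) (rule N)
  have less: "f a > 0" if "a < M" for a
    using that not_less_Least unfolding M_def by blast
  have ge: "f a = 0" if "M \<le> a" for a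
    using f[OF that] M by simp
  define p where "p = map f [0..<M]"
  have "is_partition p"
    using less by (force simp: is_partition_def p_def sorted_wrt_iff_nth_less f)
  moreover have "row p = f"
    using ge by (auto simp: row_def p_def)
  ultimately show ?thesis using that by blast
qed

lemma diagram_eq: "diagram p = Sigma UNIV (\<lambda>a. {..<row p a})"
  by (auto simp: diagram_def row_def split: if_splits)

lemma diagram_eq': "diagram p = Sigma {..<length p} (\<lambda>a. {..<row p a})"
  by (auto simp: diagram_def row_def)

lemma mem_diagram_iff: "(a, b) \<in> diagram p \<longleftrightarrow> b < row p a"
  by (simp add: diagram_eq)

lemma finite_diagram [simp]: "finite (diagram p)"
  by (simp add: diagram_eq')

lemma diagram_downward:
  assumes "is_partition p" "(a, b) \<in> diagram p" "a' \<le> a" "b' \<le> b"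
  shows "(a', b') \<in> diagram p"
  using row_antimono[OF assms(1,3)] assms(2,4) by (simp add: mem_diagram_iff)

lemma sum_diagram: "(\<Sum>c\<in>diagram p. f c) = (\<Sum>a<length p. \<Sum>b<row p a. f (a, b))"
  by (simp add: diagram_eq' sum.Sigma)

lemma card_diagram: "card (diagram p) = sum_list p"
proof -
  have "card (diagram p) = (\<Sum>a<length p. row p a)" by (simp add: diagram_eq')
  also have "\<dots> = (\<Sum>a<length p. p ! a)" by (simp add: row_def)
  finally show ?thesis by (simp add: sum_list_sum_nth atLeast0LessThan)
qed

lemma bead_less: "is_partition p \<Longrightarrow> a < b \<Longrightarrow> bead p b < bead p a"
  using row_antimono[of p a b] by (simp add: bead_def)

lemma bead_less_iff: "is_partition p \<Longrightarrow> bead p b < bead p a \<longleftrightarrow> a < b"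
  using bead_less[of p a b] bead_less[of p b a] by (cases a b rule: linorder_cases) auto

lemma inj_bead: "is_partition p \<Longrightarrow> inj (bead p)"
  using bead_less_iff by (intro injI) (metis linorder_neqE_nat order_less_irrefl)

lemma bead_beyond: "length p \<le> a \<Longrightarrow> bead p a = - int a - 1"
  by (simp add: bead_def row_def)

lemma bead_ge: "bead p a \<ge> - int a - 1"
  by (simp add: bead_def)

lemma beads_split:
  "beads p = bead p ` {..<length p} \<union> {..<- int (length p)}"
proof -
  have "bead p ` {length p..} = {..<- int (length p)}"
  proof
    show "{..<- int (length p)} \<subseteq> bead p ` {length p..}"
    proof
      fix x assume "x \<in> {..<- int (length p)}"
      hence "x = bead p (nat (- x - 1))" "nat (- x - 1) \<in> {length p..}"
        by (auto simp: bead_beyond)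
      thus "x \<in> bead p ` {length p..}" by blast
    qed
  qed (auto simp: bead_beyond)
  moreover have "beads p = bead p ` ({..<length p} \<union> {length p..})"
    unfolding beads_def by (rule arg_cong) auto
  ultimately show ?thesis by (simp only: image_Un)
qed

lemma commensurable_beads: "commensurable (beads p) {..<0}"
proof -
  have "beads p - {..<0} \<subseteq> bead p ` {..<length p}"
    by (auto simp: beads_split)
  moreover have "{..<0} - beads p \<subseteq> {- int (length p)..0}"
    by (auto simp: beads_split)
  ultimately show ?thesis
    unfolding commensurable_def by (meson finite_atLeastAtMost_int finite_subset finite_imageI finite_lessThan)
qed

text \<open>Exactly \<open>a\<close> beads lie above \<open>bead p a\<close>, so the set determines
  its decreasing enumeration and with it every row.\<close>

lemma beads_inject:
  assumes p: "is_partition p" and q: "is_partition q" and eq: "beads p = beads q"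
  shows "p = q"
proof -
  have card: "card {x \<in> beads p. bead p a < x} = a" if p: "is_partition p" for p a
  proof -
    have "{x \<in> beads p. bead p a < x} = bead p ` {..<a}"
      using bead_less_iff[OF p] by (auto simp: beads_def)
    thus ?thesis using inj_bead[OF p] by (simp add: card_image inj_on_subset)
  qed
  have "bead p a = bead q a" for a
  proof -
    have "bead p a \<in> beads q" using eq by (auto simp: beads_def)
    then obtain b where b: "bead p a = bead q b" by (auto simp: beads_def)
    have "a = b" using card[OF p, of a] card[OF q, of b] by (simp add: b eq)
    with b show ?thesis by simp
  qed
  hence "row p = row q" by (auto simp: bead_def fun_eq_iff)
  thus ?thesis by (rule row_inject[OF p q])
qed

text \<open>Row \<open>a\<close> moves a bead from \<open>- int a - 1\<close>, its place in the
  empty partition, to \<open>bead p a\<close>. The cells of the row split this move into unit steps,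
  and the sum telescopes. Constant, identity and residue indicator as \<open>K\<close> give charge,
  size and n-vector.\<close>

lemma excess_beads:
  assumes p: "is_partition p"
  shows "excess K (beads p) {..<0} = (\<Sum>(a, b)\<in>diagram p. K (int b - int a) - K (int b - int a - 1))"
proof -
  define l where "l = length p"
  have row: "(\<Sum>b<m. K (int b - int a) - K (int b - int a - 1)) = K (int m - int a - 1) - K (- int a - 1)" 
    for a m
    by (induction m) (auto simp: algebra_simps)
  have ge: "bead p a \<ge> - int l" if "a < l" for a
    using that bead_ge[of a p] by simp
  \<comment> \<open>Positions below \<open>- int l\<close> are beads both of \<open>p\<close> and of
    the empty partition; cutting them off leaves finite sums.\<close>
  define W where "W = {..<- int l}"
  have d1: "beads p - W = bead p ` {..<l}" "W - beads p = {}"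
    using ge by (fastforce simp: beads_split l_def[symmetric] W_def)+
  have d2: "{..<0} - W = (\<lambda>a. - int a - 1) ` {..<l}" "W - {..<0} = {}"
    by (auto simp: W_def image_iff intro!: bexI[of _ "nat (- _ - 1)"])
  have c: "commensurable (beads p) W" "commensurable W {..<0}"
    by (simp_all add: commensurable_def d1 d2)
  have "excess K (beads p) {..<0} = excess K (beads p) W - excess K {..<0} W"
    using excess_trans[OF c, of K] excess_swap[of K "{..<0}" W] by simp
  also have "excess K (beads p) W = (\<Sum>a<l. K (bead p a))"
    using inj_bead[OF p] by (simp add: excess_def d1 sum.reindex inj_on_subset)
  also have "excess K {..<0} W = (\<Sum>a<l. K (- int a - 1))"
    by (simp add: excess_def d2 sum.reindex inj_on_def)
  finally show ?thesis
    by (simp add: sum_diagram row l_def bead_def) (simp add: sum_subtractf)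
qed

lemma excess_beads_1: "is_partition p \<Longrightarrow> excess (\<lambda>x. 1) (beads p) {..<0} = 0"
  by (simp add: excess_beads)

lemma excess_beads_id: "is_partition p \<Longrightarrow> excess (\<lambda>x. x) (beads p) {..<0} = int (sum_list p)"
  by (simp add: excess_beads card_diagram split_beta)

lemma res_count_eq_sum:
  "res_count t p i = (\<Sum>(a, b)\<in>diagram p. of_bool ((int b - int a) mod int t = int i))"
  by (simp add: res_count_def split_beta of_bool_def sum.If_cases Int_def)
    (rule arg_cong[where f = card], auto)

text \<open>With the indicator of residue \<open>i\<close> as \<open>K\<close>, a cell counts
  positively if its content has residue \<open>i\<close> and negatively if it has residue
  \<open>i + 1\<close>.\<close>

lemma nvec_eq_excess:
  assumes p: "is_partition p" and i: "i < t"
  shows "nvec t p i = excess (\<lambda>x. of_bool (x mod int t = int i)) (beads p) {..<0}"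
proof -
  have *: "(x - 1) mod int t = int i \<longleftrightarrow> x mod int t = int ((i + 1) mod t)" for x
  proof -
    have "(x - 1) mod int t = int i \<longleftrightarrow> (x - 1) mod int t = int i mod int t" using i by simp
    also have "\<dots> \<longleftrightarrow> x mod int t = (int i + 1) mod int t"
      by (metis diff_add_cancel mod_add_left_eq mod_diff_left_eq add_diff_cancel)
    finally show ?thesis by (simp add: zmod_int add.commute)
  qed
  show ?thesis unfolding excess_beads[OF p] nvec_def res_count_eq_sum *
    by (simp add: split_beta sum_subtractf)
qed

text \<open>Below some \<open>- int N\<close> every position is occupied, so relative charge 0
  leaves exactly \<open>N\<close> further elements; in decreasing order they are the beads of the
  first \<open>N\<close> rows.\<close>

lemma partition_of_beads:
  assumes S: "commensurable S {..<0}" and S0: "excess (\<lambda>x. 1) S {..<0} = 0"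
  obtains p where "is_partition p" "beads p = S"
proof -
  obtain N :: nat where N: "{..<- int N} \<subseteq> S"
  proof -
    have f: "finite ({..<0} - S)" using S by (simp add: commensurable_def)
    obtain b where b: "\<And>x. x \<in> {..<0} - S \<Longrightarrow> b \<le> x"
      using f by (metis bdd_below.E bdd_below_finite)
    have "{..<- int (nat (- b))} \<subseteq> S"
    proof
      fix x assume "x \<in> {..<- int (nat (- b))}"
      thus "x \<in> S" using b[of x] by (cases "b \<le> 0") auto
    qed
    thus ?thesis using that by blast
  qed
  define W where "W = {..<- int N}"
  define T where "T = S - W"
  have c: "commensurable W {..<0}"
  proof -
    have "{..<0} - W \<subseteq> {- int N..0}" "W - {..<0} = {}" by (auto simp: W_def)
    thus ?thesis unfolding commensurable_def by (metis finite.emptyI finite_atLeastAtMost_int finite_subset)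
  qed
  have cS: "commensurable S W" by (rule commensurable_trans[OF S commensurable_sym[OF c]])
  have WS: "W - S = {}" using N by (auto simp: W_def)
  have fT: "finite T" using cS by (simp add: commensurable_def T_def)
  have "excess (\<lambda>x. 1) S W = excess (\<lambda>x. 1) {..<0} W"
    using excess_trans[OF cS c, of "\<lambda>x. 1"] S0 excess_swap[of "\<lambda>x. 1" W "{..<0}"] by simp
  moreover have "{..<0} - W = {- int N..<0}" "W - {..<0} = {}" by (auto simp: W_def)
  ultimately have cT: "card T = N" by (simp add: excess_def T_def WS)
  define s where "s = sorted_list_of_set T"
  have s: "length s = N" "set s = T" "sorted_wrt (<) s"
    using fT cT by (simp_all add: s_def)
  \<comment> \<open>A strictly increasing integer sequence starting at or above
    \<open>- int N\<close> gains at least one per step. Hence \<open>nat\<close> cuts nothing off in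
    the row lengths \<open>f\<close> below.\<close>
  have s_ge: "s ! k \<ge> int k - int N" if "k < N" for k
    using that
  proof (induction k)
    case 0
    hence "s ! 0 \<in> T" using s by (metis nth_mem)
    thus ?case by (simp add: T_def W_def)
  next
    case (Suc k)
    hence "s ! k < s ! Suc k" using s by (simp add: sorted_wrt_iff_nth_less)
    with Suc show ?case by simp
  qed
  define f where "f = (\<lambda>a. if a < N then nat (s ! (N - 1 - a) + int a + 1) else 0)"
  have fa: "int (f a) = s ! (N - 1 - a) + int a + 1" if "a < N" for a
    using s_ge[of "N - 1 - a"] that by (simp add: f_def)
  have mono: "f (Suc a) \<le> f a" for a
  proof (cases "Suc a < N")
    case True
    hence "s ! (N - 1 - Suc a) < s ! (N - 1 - a)"
      using s by (simp add: sorted_wrt_iff_nth_less)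
    thus ?thesis using fa[of a] fa[of "Suc a"] True by simp
  qed (simp add: f_def)
  have "f b \<le> f a" if "a \<le> b" for a b
    using lift_Suc_antimono_le[of f, OF mono that] .
  moreover have "f N = 0" by (simp add: f_def)
  ultimately obtain p where p: "is_partition p" "row p = f"
    by (rule partition_of_rows)
  have "length p \<le> N" using row_eq_0_iff[OF p(1), of N] by (simp add: p f_def)
  have "bead p ` {..<N} = T"
  proof -
    have "bead p a = s ! (N - 1 - a)" if "a < N" for a
      using fa[OF that] by (simp add: bead_def p)
    hence "bead p ` {..<N} = (\<lambda>a. s ! (N - 1 - a)) ` {..<N}" by auto
    also have "\<dots> = (!) s ` ((\<lambda>a. N - 1 - a) ` {..<N})" by (simp add: image_image)
    also have "(\<lambda>a. N - 1 - a) ` {..<N} = {..<N}"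
    proof
      show "{..<N} \<subseteq> (\<lambda>a. N - 1 - a) ` {..<N}"
      proof
        fix a assume "a \<in> {..<N}"
        hence "a = N - 1 - (N - 1 - a)" "N - 1 - a \<in> {..<N}" by auto
        thus "a \<in> (\<lambda>a. N - 1 - a) ` {..<N}" by blast
      qed
    qed auto
    also have "(!) s ` {..<N} = T" using s(1,2) by (metis atLeast0LessThan list.set_map map_nth set_upt)
    finally show ?thesis .
  qed
  moreover have "bead p ` {N..} = W"
  proof
    show "W \<subseteq> bead p ` {N..}"
    proof
      fix x assume "x \<in> W"
      hence "x = bead p (nat (- x - 1))" "nat (- x - 1) \<in> {N..}"
        using \<open>length p \<le> N\<close> by (auto simp: bead_beyond W_def)
      thus "x \<in> bead p ` {N..}" by blast
    qed
  qed (use \<open>length p \<le> N\<close> in \<open>auto simp: bead_beyond W_def\<close>)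
  moreover have "beads p = bead p ` ({..<N} \<union> {N..})"
    unfolding beads_def by (rule arg_cong) auto
  ultimately have "beads p = T \<union> W" by (simp only: image_Un)
  also have "\<dots> = S" using WS by (auto simp: T_def)
  finally show ?thesis using that p(1) by blast
qed

subsection \<open>Rim hooks and cores\<close>

definition content :: "nat \<times> nat \<Rightarrow> int" where
  "content u = int (snd u) - int (fst u)"

text \<open>A discrete intermediate value theorem: adjacent cells differ by one in content, so a
  path realises every content between those of its ends.\<close>

lemma contents_connected:
  assumes S: "cells_connected S" and u: "u \<in> S" and v: "v \<in> S"
  shows "{content u..content v} \<subseteq> content ` S"
proof -
  have "(u, v) \<in> {(u, v). u \<in> S \<and> v \<in> S \<and> cell_adj u v}\<^sup>*"
    using assms by (simp add: cells_connected_def)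
  thus ?thesis
  proof (induction rule: rtrancl_induct)
    case base
    thus ?case using u by auto
  next
    case (step y z)
    hence "content z \<le> content y + 1" "z \<in> S" by (auto simp: cell_adj_def content_def)
    hence "{content u..content z} \<subseteq> insert (content z) {content u..content y}" by auto
    thus ?case using step.IH \<open>z \<in> S\<close> by auto
  qed
qed

text \<open>A skew shape contains every cell lying between two of its cells; two distinct cells on
  one diagonal would therefore force a 2x2 square.\<close>

lemma inj_on_content_skew:
  assumes p: "is_partition p" and q: "is_partition q" and "no_2x2 (diagram p - diagram q)"
  shows "inj_on content (diagram p - diagram q)"
proof -
  let ?S = "diagram p - diagram q"
  have convex: "(a', b') \<in> ?S"
    if "(a, b) \<in> ?S" "(a'', b'') \<in> ?S" "a \<le> a'" "a' \<le> a''" "b \<le> b'" "b' \<le> b''" for a b a' b' a'' b''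
    using that diagram_downward[OF p, of a'' b'' a' b'] diagram_downward[OF q, of a' b' a b] by auto
  have False if u: "(a, b) \<in> ?S" and v: "(a', b') \<in> ?S" and "a < a'" "int b - int a = int b' - int a'" for a b a' b'
  proof -
    have "b < b'" using that by linarith
    hence "{(a, b), (a + 1, b), (a, b + 1), (a + 1, b + 1)} \<subseteq> ?S"
      using convex[OF u v] \<open>a < a'\<close> by auto
    thus False using assms(3) unfolding no_2x2_def by blast
  qed
  note * = this
  show ?thesis
  proof (rule inj_onI)
    fix u v assume uv: "u \<in> ?S" "v \<in> ?S" "content u = content v"
    obtain a b a' b' where [simp]: "u = (a, b)" "v = (a', b')" by fastforce
    have "a = a'"
      using *[of a b a' b'] *[of a' b' a b] uv by (cases a a' rule: linorder_cases) (auto simp: content_def)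
    thus "u = v" using uv(3) by (simp add: content_def)
  qed
qed

text \<open>Connectedness makes the contents an interval and the absence of 2x2 squares makes them
  distinct; so they are consecutive and meet each residue once.\<close>

lemma remove_hook_contents:
  assumes "remove_hook t p q" "t > 0"
  obtains l where "bij_betw content (diagram p - diagram q) {l..<l + int t}"
proof -
  let ?S = "diagram p - diagram q"
  have inj: "inj_on content ?S"
    using assms inj_on_content_skew by (auto simp: remove_hook_def)
  have t: "card ?S = t" and con: "cells_connected ?S"
    using assms by (auto simp: remove_hook_def)
  define C where "C = content ` ?S"
  have C: "finite C" "C \<noteq> {}" "card C = t"
  proof -
    show "C \<noteq> {}" using t \<open>t > 0\<close> by (metis C_def card.empty image_is_empty less_irrefl)
  qed (use inj t in \<open>auto simp: C_def card_image\<close>)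
  have "{Min C..Max C} \<subseteq> C"
    using contents_connected[OF con] Min_in[OF C(1,2)] Max_in[OF C(1,2)] unfolding C_def by fastforce
  then obtain l h where eq: "C = {l..h}" using C by (metis Max_ge Min_le atLeastAtMost_iff subsetI subset_antisym)
  with C(3) have "int t = h - l + 1" using \<open>t > 0\<close> by auto
  with eq have "C = {l..<l + int t}" by auto
  thus ?thesis using that inj by (simp add: bij_betw_def C_def)
qed

lemma card_residue_window:
  assumes "i < t"
  shows "card {x \<in> {l..<l + int t}. x mod int t = int i} = 1"
proof -
  define y where "y = l + (int i - l) mod int t"
  have y: "y \<in> {l..<l + int t}" "y mod int t = int i"
    using assms by (auto simp: y_def mod_add_right_eq)
  have "x = y" if x: "x \<in> {l..<l + int t}" "x mod int t = int i" for x
  proof -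
    have "int t dvd x - y" using x y by (metis mod_eq_dvd_iff)
    moreover have "\<bar>x - y\<bar> < int t" using x y by auto
    ultimately show "x = y" using dvd_imp_le_int[of "x - y" "int t"] by (cases "x = y") auto
  qed
  hence "{x \<in> {l..<l + int t}. x mod int t = int i} = {y}" using y by blast
  thus ?thesis by simp
qed

lemma res_count_remove_hook:
  assumes h: "remove_hook t p q" and i: "i < t"
  shows "res_count t p i = res_count t q i + 1"
proof -
  define P where "P = (\<lambda>u. content u mod int t = int i)"
  obtain l where l: "bij_betw content (diagram p - diagram q) {l..<l + int t}"
    using remove_hook_contents[OF h] i by auto
  have rc: "res_count t r i = int (card {u \<in> diagram r. P u})" for r
    unfolding res_count_def P_def content_def
    by (rule arg_cong[where f = "\<lambda>X. int (card X)"]) auto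
  have "content ` {u \<in> diagram p - diagram q. P u} = {x \<in> {l..<l + int t}. x mod int t = int i}"
    using l by (auto simp: P_def bij_betw_def)
  moreover have "inj_on content {u \<in> diagram p - diagram q. P u}"
    using l by (auto simp: bij_betw_def intro: inj_on_subset)
  ultimately have "card {u \<in> diagram p - diagram q. P u} = 1"
    using card_residue_window[OF i, of l] by (metis card_image)
  moreover have "{u \<in> diagram p. P u} = {u \<in> diagram q. P u} \<union> {u \<in> diagram p - diagram q. P u}"
    using h by (auto simp: remove_hook_def)
  moreover have "card ({u \<in> diagram q. P u} \<union> {u \<in> diagram p - diagram q. P u})
      = card {u \<in> diagram q. P u} + card {u \<in> diagram p - diagram q. P u}"
    by (rule card_Un_disjoint) auto
  ultimately show ?thesis by (simp add: rc)
qed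

lemma nvec_remove_hook:
  assumes "remove_hook t p q" and "i < t"
  shows "nvec t p i = nvec t q i"
  using assms by (simp add: nvec_def res_count_remove_hook)

lemma nvec_remove_hooks:
  assumes "(remove_hook t)\<^sup>*\<^sup>* p q" and "i < t"
  shows "nvec t p i = nvec t q i"
  using assms by (induction rule: rtranclp_induct) (auto simp: nvec_remove_hook)

lemma ex_core:
  assumes "is_partition p" "t > 0"
  shows "\<exists>k. is_core t k \<and> (remove_hook t)\<^sup>*\<^sup>* p k"
  using assms(1)
proof (induction "card (diagram p)" arbitrary: p rule: less_induct)
  case less
  show ?case
  proof (cases "is_core t p")
    case False
    then obtain q where q: "remove_hook t p q" using less.prems by (auto simp: is_core_def)
    hence "diagram p - diagram q \<noteq> {}" "diagram q \<subseteq> diagram p" "is_partition q"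
      using \<open>t > 0\<close> by (auto simp: remove_hook_def)
    hence "card (diagram q) < card (diagram p)"
      by (intro psubset_card_mono) auto
    then obtain k where "is_core t k" "(remove_hook t)\<^sup>*\<^sup>* q k"
      using less.hyps \<open>is_partition q\<close> by blast
    thus ?thesis using q by (meson converse_rtranclp_into_rtranclp)
  qed blast
qed

text \<open>Moving the bead \<open>x\<close> down to the vacant place \<open>x - int t\<close>
  shifts the index of every bead in between by one. The rows concerned lose a border strip.\<close>

lemma ex_remove_hook:
  assumes p: "is_partition p" and x: "x \<in> beads p" and y: "x - int t \<notin> beads p"
  shows "\<exists>q. remove_hook t p q"
proof -
  obtain a where a: "x = bead p a" using x by (auto simp: beads_def)
  define y where "y = x - int t"
  have ynb: "bead p e \<noteq> y" for e using y by (metis y_def beads_def rangeI)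
  have "x \<noteq> y" using ynb[of a] a by simp
  hence "y < x" by (simp add: y_def)
  define C where "C = {e. y < bead p e}"
  have "C \<subseteq> {..<max (length p) (nat (- y))}"
  proof
    fix e assume "e \<in> C"
    thus "e \<in> {..<max (length p) (nat (- y))}"
      by (cases "length p \<le> e") (auto simp: C_def bead_beyond)
  qed
  hence fin: "finite C" by (rule finite_subset) simp
  have "a \<in> C" using \<open>y < x\<close> a by (simp add: C_def)
  \<comment> \<open>Row \<open>c\<close> carries the lowest bead above \<open>y\<close>; the strip
    will occupy rows \<open>a\<close> to \<open>c\<close>.\<close>
  define c where "c = Max C"
  have "c \<in> C" "a \<le> c" using fin \<open>a \<in> C\<close> unfolding c_def by (auto intro: Max_in)
  have "Suc c \<notin> C" using Max_ge[OF fin, of "Suc c"] by (auto simp: c_def)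
  have bc: "y < bead p c" using \<open>c \<in> C\<close> by (simp add: C_def)
  have bSc: "bead p (Suc c) < y" using \<open>Suc c \<notin> C\<close> ynb[of "Suc c"] by (simp add: C_def)
  have rmono: "row p e' \<le> row p e" if "e \<le> e'" for e e' by (rule row_antimono[OF p that])
  have yc: "y + int c + 1 \<ge> 0" "y + int c + 1 < int (row p c)" "int (row p (Suc c)) \<le> y + int c + 1"
    using bSc bc by (auto simp: bead_def)
  have rpos: "row p e > 0" if "e \<le> c" for e
    using rmono[OF that] yc by simp
  \<comment> \<open>Bead \<open>e + 1\<close> becomes bead \<open>e\<close> for
    \<open>a \<le> e < c\<close>, whence the row length \<open>row p (Suc e) - 1\<close>; in row
    \<open>c\<close> the new bead is \<open>y\<close>.\<close>
  define f where "f = (\<lambda>e. if e < a then row p e else if e < c then row p (Suc e) - 1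
      else if e = c then nat (y + int c + 1) else row p e)"
  have f_le: "f e \<le> row p e" for e
    using rmono[of e "Suc e"] yc by (auto simp: f_def)
  have mono: "f (Suc e) \<le> f e" for e
  proof -
    consider "Suc e < a" | "Suc e = a" | "a \<le> e" "Suc e < c" | "a \<le> e" "Suc e = c" | "e = c" | "c < e"
      using \<open>a \<le> c\<close> by linarith
    thus ?thesis
    proof cases
      case 2
      thus ?thesis using f_le[of "Suc e"] rmono[of e "Suc e"] by (simp add: f_def[THEN fun_cong, of e])
    next
      case 3
      thus ?thesis using rmono[of "Suc e" "Suc (Suc e)"] by (simp add: f_def)
    qed (use \<open>a \<le> c\<close> yc rmono[of e "Suc e"] in \<open>auto simp: f_def\<close>)
  qed
  have fanti: "f e' \<le> f e" if "e \<le> e'" for e e'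
    by (rule lift_Suc_antimono_le[of f, OF mono that])
  have "f (Suc c + length p) = 0" using \<open>a \<le> c\<close> by (simp add: f_def row_def)
  with fanti obtain q where q: "is_partition q" "row q = f"
    by (rule partition_of_rows)
  define S where "S = diagram p - diagram q"
  have mem: "(e, b) \<in> S \<longleftrightarrow> f e \<le> b \<and> b < row p e" for e b
    by (auto simp: S_def mem_diagram_iff q)
  have rng: "a \<le> e \<and> e \<le> c" if "(e, b) \<in> S" for e b
    using that \<open>a \<le> c\<close> unfolding mem by (auto simp: f_def split: if_splits)
  have Sigma: "S = Sigma {a..c} (\<lambda>e. {f e..<row p e})"
    using mem rng by auto
  have card: "card S = t"
  proof -
    \<comment> \<open>Row \<open>e < c\<close> loses \<open>bead p e - bead p (Suc e)\<close> cells
      and row \<open>c\<close> loses \<open>bead p c - y\<close>; the total telescopes to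
      \<open>x - y\<close>.\<close>
    have "int (card S) = (\<Sum>e=a..c. int (row p e) - int (f e))"
      by (simp add: Sigma f_le of_nat_diff)
    also have "\<dots> = (\<Sum>e=a..<c. int (row p e) - int (f e)) + (int (row p c) - int (f c))"
      using \<open>a \<le> c\<close> by (simp add: sum.last_plus)
    also have "(\<Sum>e=a..<c. int (row p e) - int (f e)) = (\<Sum>e=a..<c. - bead p (Suc e) - - bead p e)"
    proof (rule sum.cong)
      fix e assume "e \<in> {a..<c}"
      thus "int (row p e) - int (f e) = - bead p (Suc e) - - bead p e"
        using rpos[of "Suc e"] by (simp add: f_def bead_def of_nat_diff)
    qed simp
    also have "\<dots> = bead p a - bead p c"
      using \<open>a \<le> c\<close> by (subst sum_Suc_diff') auto
    also have "int (row p c) - int (f c) = bead p c - y"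
      using yc \<open>a \<le> c\<close> by (simp add: f_def bead_def)
    finally show ?thesis using a by (simp add: y_def)
  qed
  have no22: "no_2x2 S"
  proof -
    have False if "(e, b) \<in> S" "(e + 1, b + 1) \<in> S" for e b
    proof -
      have "a \<le> e" "e < c" using rng that by fastforce+
      \<comment> \<open>Row \<open>e + 1\<close> ends in the very column in which the strip starts
        in row \<open>e\<close>, so no diagonal pair of cells fits.\<close>
      hence "f e = row p (Suc e) - 1" by (simp add: f_def)
      thus False using that unfolding mem by auto
    qed
    thus ?thesis unfolding no_2x2_def by blast
  qed
  define R where "R = {(u, v). u \<in> S \<and> v \<in> S \<and> cell_adj u v}"
  have symR: "sym R" by (auto simp: sym_def R_def cell_adj_def)
  \<comment> \<open>From each cell of the strip, going right if possible and up otherwise leads to the last cell of row a.\<close>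
  have reach: "(u, (a, row p a - 1)) \<in> R\<^sup>*" if "u \<in> S" for u
    using that
  proof (induction "nat (bead p a - content u)" arbitrary: u rule: less_induct)
    case less
    obtain e b where [simp]: "u = (e, b)" by fastforce
    have e: "a \<le> e" "e \<le> c" "f e \<le> b" "b < row p e" using less.prems rng mem by auto
    show ?case
    proof (cases "u = (a, row p a - 1)")
      case False
      define v where "v = (if b + 1 < row p e then (e, b + 1) else (e - 1, b))"
      have v: "v \<in> S \<and> cell_adj u v \<and> content v = content u + 1"
      proof (cases "b + 1 < row p e")
        case True
        thus ?thesis using e by (simp add: v_def mem cell_adj_def content_def)
      next
        case F: False
        hence b: "b = row p e - 1" using e by simp
        hence "a < e" using False e by (cases "a = e") auto
        then obtain e' where e': "e = Suc e'" by (cases e) auto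
        hence "f e' = row p e - 1" using \<open>a < e\<close> e by (simp add: f_def)
        thus ?thesis using F e e' b rmono[of e' e] by (simp add: v_def mem cell_adj_def content_def)
      qed
      have "content u < bead p a"
      proof -
        have "int b - int e \<le> bead p e" using e by (simp add: bead_def)
        also have "\<dots> \<le> bead p a" using bead_less[OF p, of a e] e by (cases "a = e") auto
        finally have "content u \<le> bead p a" by (simp add: content_def)
        moreover have "content u \<noteq> bead p a"
        proof
          assume "content u = bead p a"
          hence "a = e" "b = row p e - 1"
            using e rmono[of a e] by (auto simp: content_def bead_def)
          thus False using False by simp
        qed
        ultimately show ?thesis by simp
      qed
      hence "(v, (a, row p a - 1)) \<in> R\<^sup>*"
        using v by (intro less.hyps) auto
      moreover have "(u, v) \<in> R" using v less.prems by (simp add: R_def)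
      ultimately show ?thesis by (rule converse_rtrancl_into_rtrancl[rotated])
    qed simp
  qed
  have "cells_connected S"
    unfolding cells_connected_def R_def[symmetric]
  proof (intro ballI)
    fix u v assume "u \<in> S" "v \<in> S"
    from reach[OF this(1)] symD[OF sym_rtrancl[OF symR] reach[OF this(2)]]
    show "(u, v) \<in> R\<^sup>*" by (rule rtrancl_trans)
  qed
  moreover have "diagram q \<subseteq> diagram p"
    using f_le by (auto simp: mem_diagram_iff q) (meson less_le_trans)
  ultimately have "remove_hook t p q"
    using p q card no22 by (simp add: remove_hook_def S_def)
  thus ?thesis by blast
qed

section \<open>Cores are determined by their n-vectors\<close>

lemma core_beads_flush:
  assumes "is_core t k" "x \<in> beads k"
  shows "x - int t \<in> beads k"
  using assms ex_remove_hook by (auto simp: is_core_def)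

text \<open>Each runner is filled from below in both sets. If \<open>x\<close> lies in
  \<open>A\<close> but not in \<open>B\<close>, every element of \<open>B\<close> on its runner lies
  below \<open>x\<close>, hence in \<open>A\<close>; then \<open>A\<close> has a larger count on
  that runner.\<close>

lemma flush_subset:
  assumes A: "\<And>x. x \<in> A \<Longrightarrow> x - int t \<in> A" and B: "\<And>x. x \<in> B \<Longrightarrow> x - int t \<in> B"
    and cA: "commensurable A {..<0}" and cB: "commensurable B {..<0}" and t: "t > 0"
    and eq: "\<And>i. i < t \<Longrightarrow> excess (\<lambda>x. of_bool (x mod int t = int i)) A {..<0} =
                              excess (\<lambda>x. of_bool (x mod int t = int i)) B {..<0}"
  shows "A \<subseteq> B"
proof (rule ccontr)
  assume "\<not> A \<subseteq> B"
  then obtain x where x: "x \<in> A" "x \<notin> B" by blast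
  have down: "y - int t * int k \<in> C" if "\<And>x. x \<in> C \<Longrightarrow> x - int t \<in> C" "y \<in> C" for C y k
  proof (induction k)
    case (Suc k)
    thus ?case using that(1)[OF Suc] by (simp add: algebra_simps)
  qed (use that in simp)
  define i where "i = nat (x mod int t)"
  have i: "i < t" "int i = x mod int t" using t by (simp_all add: i_def nat_less_iff)
  define K where "K = (\<lambda>y. of_bool (y mod int t = int i) :: int)"
  have zero: "K y = 0" if "y \<in> B - A" for y
  proof (rule ccontr)
    assume "K y \<noteq> 0"
    hence "y mod int t = x mod int t" by (simp add: K_def i split: if_splits)
    then obtain m where m: "y = x + int t * m" by (metis mod_eqE)
    show False
    proof (cases "m \<ge> 0")
      case True
      thus False using down[of B y "nat m"] B that x m by simp
    next
      case False
      thus False using down[of A x "nat (- m)"] A that x m by simp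
    qed
  qed
  have cAB: "commensurable A B" using cA cB commensurable_sym commensurable_trans by blast
  have "excess K A B + excess K B {..<0} = excess K A {..<0}"
    by (rule excess_trans[OF cAB cB])
  hence "excess K A B = 0" using eq[OF i(1)] by (simp add: K_def)
  moreover have "sum K (B - A) = 0" using zero by (intro sum.neutral) auto
  moreover have "K x \<le> sum K (A - B)"
    using cAB x by (intro member_le_sum) (auto simp: K_def commensurable_def)
  moreover have "K x = 1" by (simp add: K_def i)
  ultimately show False by (simp add: excess_def)
qed

lemma core_unique:
  assumes "is_core t k" "is_core t l" "t > 0" "\<And>i. i < t \<Longrightarrow> nvec t k i = nvec t l i"
  shows "k = l"
proof (rule beads_inject)
  show p: "is_partition k" "is_partition l" using assms by (auto simp: is_core_def)
  show "beads k = beads l"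
    by (intro equalityI flush_subset[of _ t] core_beads_flush[of t] commensurable_beads)
       (use assms nvec_eq_excess[OF p(1)] nvec_eq_excess[OF p(2)] in auto)
qed

text \<open>The description in \<open>core\<close> is proper: removing hooks reaches some core, and
  any two cores so reached inherit the n-vector of \<open>p\<close> and coincide. The crank can thus
  be read off the beads of \<open>p\<close> itself.\<close>

lemma nvec_core:
  assumes p: "is_partition p" and i: "i < t"
  shows "nvec t (core t p) i = nvec t p i"
proof -
  have "\<exists>!k. is_core t k \<and> (remove_hook t)\<^sup>*\<^sup>* p k"
  proof (rule ex_ex1I)
    show "\<exists>k. is_core t k \<and> (remove_hook t)\<^sup>*\<^sup>* p k" using ex_core p i by auto
    show "k = l" if "is_core t k \<and> (remove_hook t)\<^sup>*\<^sup>* p k" "is_core t l \<and> (remove_hook t)\<^sup>*\<^sup>* p l" for k l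
      using that i by (intro core_unique[of t]) (auto simp flip: nvec_remove_hooks)
  qed
  from theI'[OF this] have "(remove_hook t)\<^sup>*\<^sup>* p (core t p)" by (simp add: core_def)
  thus ?thesis using nvec_remove_hooks i by metis
qed

subsection \<open>The Stanley rank modulo 4\<close>

lemma sum_alternating: "(\<Sum>b<m. (- 1) ^ b) = (of_bool (odd m) :: int)"
  by (induction m) auto

lemma num_odd_eq_sum: "int (num_odd p) = (\<Sum>(a, b)\<in>diagram p. (- 1) ^ b)"
proof -
  have "{a. a < length p \<and> odd (p ! a)} = {a \<in> {..<length p}. odd (row p a)}"
    by (auto simp: row_def)
  hence "int (num_odd p) = (\<Sum>a<length p. of_bool (odd (row p a)))"
    by (simp add: num_odd_def length_filter_conv_card of_bool_def sum.If_cases Int_def)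
  thus ?thesis by (simp add: sum_diagram sum_alternating)
qed

text \<open>Parts of the conjugate are columns, so the sign alternates with the row index and a
  column contributes the parity of its height.\<close>

lemma num_odd_conj_eq_sum:
  assumes p: "is_partition p"
  shows "int (num_odd (conj_part p)) = (\<Sum>(a, b)\<in>diagram p. (- 1) ^ a)"
proof -
  define h where "h = (\<lambda>b. length (filter (\<lambda>x. b < x) p))"
  \<comment> \<open>Rows longer than \<open>b\<close> form an initial segment, so their number
    \<open>h b\<close> is the height of column \<open>b\<close>.\<close>
  have h: "(a, b) \<in> diagram p \<longleftrightarrow> a < h b" for a b
  proof -
    define l where "l = (LEAST a. \<not> b < row p a)"
    have "\<not> b < row p (length p)" by (simp add: row_def)
    hence l: "\<not> b < row p l" unfolding l_def by (rule LeastI)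
    have less: "b < row p a" if "a < l" for a
      using that not_less_Least unfolding l_def by blast
    have iff: "b < row p a \<longleftrightarrow> a < l" for a
      using l less[of a] row_antimono[OF p, of l a] by (cases "a < l") auto
    have "h b = card {a. a < length p \<and> b < p ! a}"
      by (simp add: h_def length_filter_conv_card)
    also have "{a. a < length p \<and> b < p ! a} = {a. b < row p a}" by (auto simp: row_def)
    also have "card \<dots> = l" by (simp add: iff)
    finally show ?thesis by (simp add: mem_diagram_iff iff)
  qed
  define M where "M = (if p = [] then 0 else hd p)"
  have M: "M = row p 0" by (simp add: M_def row_def hd_conv_nth)
  have eq: "diagram p = (\<lambda>(b, a). (a, b)) ` Sigma {..<M} (\<lambda>b. {..<h b})" (is "_ = ?g ` ?B")
  proof -
    have "b < M" if "(a, b) \<in> diagram p" for a b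
      using diagram_downward[OF p that, of 0 b] by (simp add: M mem_diagram_iff)
    thus ?thesis by (auto simp: h image_iff)
  qed
  have "int (num_odd (conj_part p)) = (\<Sum>b<M. of_bool (odd (h b)))"
  proof -
    have "num_odd (conj_part p) = card {b. b < M \<and> odd (h b)}"
      unfolding num_odd_def conj_part_def h_def[symmetric] M_def[symmetric]
      by (simp add: length_filter_conv_card cong: conj_cong)
    thus ?thesis by (simp add: of_bool_def sum.If_cases Int_def)
  qed
  also have "\<dots> = (\<Sum>b<M. \<Sum>a<h b. (- 1) ^ a)" by (simp add: sum_alternating)
  also have "\<dots> = (\<Sum>(b, a)\<in>?B. (- 1) ^ a)" by (simp add: sum.Sigma)
  also have "\<dots> = (\<Sum>(a, b)\<in>diagram p. (- 1) ^ a)"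
    unfolding eq by (subst sum.reindex) (auto simp: inj_on_def split_beta)
  finally show ?thesis .
qed

text \<open>Both sides are sums over cells. With 0-based indices their contributions differ by -4 at
  a cell in an even row and an odd column, and agree elsewhere.\<close>

lemma srank_mod_4:
  assumes p: "is_partition p"
  shows "srank p mod 4 = (int (sum_list p) - nvec 2 p 0) mod 4"
proof -
  have "srank p - (int (sum_list p) - nvec 2 p 0) =
    (\<Sum>(a, b)\<in>diagram p. (- 1) ^ b - (- 1) ^ a - 1
       + (of_bool ((int b - int a) mod 2 = 0) - of_bool ((int b - int a) mod 2 = 1)))"
    unfolding srank_def num_odd_conj_eq_sum[OF p] unfolding num_odd_eq_sum[of p]
    by (simp add: nvec_def res_count_eq_sum card_diagram[symmetric] split_beta sum_subtractf sum.distrib)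
  also have "4 dvd \<dots>"
  proof (rule dvd_sum, clarify)
    fix a b :: nat
    show "(4::int) dvd (- 1) ^ b - (- 1) ^ a - 1
       + (of_bool ((int b - int a) mod 2 = 0) - of_bool ((int b - int a) mod 2 = 1))"
      by (cases "even a"; cases "even b") (auto simp: even_iff_mod_2_eq_zero[symmetric] odd_iff_mod_2_eq_one[symmetric])
  qed
  finally show ?thesis by (simp add: mod_eq_dvd_iff)
qed

subsection \<open>Moving the runners of the 5-abacus\<close>

text \<open>The n-vector as seen on the abacus, extended with period 5 so that n-vectors can be
  equated as functions on the integers.\<close>

definition charge :: "int set \<Rightarrow> int \<Rightarrow> int" where
  "charge B i = excess (\<lambda>x. of_bool (x mod 5 = i mod 5)) B {..<0}"

lemma charge_mod: "charge B (i mod 5) = charge B i"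
  by (simp add: charge_def)

lemma excess_periodic:
  "excess (\<lambda>x. g (x mod 5)) B {..<0} = (\<Sum>i\<in>{0..<5}. g i * charge B i)"
proof -
  have "g (x mod 5) = (\<Sum>i\<in>{0..<5}. g i * of_bool (x mod 5 = i mod 5))" for x :: int
  proof -
    have "(\<Sum>i\<in>{0..<5}. g i * of_bool (x mod 5 = i mod 5)) = (\<Sum>i\<in>{0..<5}. if x mod 5 = i then g i else 0)"
      by (rule sum.cong) auto
    thus ?thesis by simp
  qed
  hence "(\<lambda>x. g (x mod 5)) = (\<lambda>x. \<Sum>i\<in>{0..<5}. g i * of_bool (x mod 5 = i mod 5))" by (rule ext)
  thus ?thesis by (simp only: excess_sum excess_mult charge_def)
qed

lemma sum_charge_beads:
  assumes "is_partition p"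
  shows "(\<Sum>i\<in>{0..<5}. charge (beads p) i) = 0"
  using excess_periodic[of "\<lambda>_. 1" "beads p"] excess_beads_1[OF assms] by simp

text \<open>The size is the relative sum of the beads \<open>x\<close>; modulo 5 only the part
  \<open>x mod 5\<close> counts.\<close>

lemma weighted_sum_charge_beads:
  assumes "is_partition p"
  shows "(\<Sum>i\<in>{0..<5}. i * charge (beads p) i) mod 5 = int (sum_list p) mod 5"
proof -
  have "int (sum_list p) = excess (\<lambda>x. x mod 5 + 5 * (x div 5)) (beads p) {..<0}"
    using excess_beads_id[OF assms] by simp
  also have "\<dots> = (\<Sum>i\<in>{0..<5}. i * charge (beads p) i) + 5 * excess (\<lambda>x. x div 5) (beads p) {..<0}"
    unfolding excess_add excess_mult using excess_periodic[of "\<lambda>i. i" "beads p"] by simp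
  finally show ?thesis by simp
qed

lemma nvec_eq_charge: "is_partition p \<Longrightarrow> i < 5 \<Longrightarrow> nvec 5 p i = charge (beads p) (int i)"
  by (simp add: nvec_eq_excess charge_def)

lemma crank5_eq:
  assumes "is_partition p"
  shows "crank5 p = (let n = charge (beads p) in 2 * (1 + n 0 - n 1 - n 2 + n 3)) mod 5"
  using assms by (simp add: crank5_def Let_def nvec_core nvec_eq_charge)

text \<open>Sends the end \<open>5 * n i + i\<close> of runner \<open>i\<close> of the abacus, as well as all beads of that runner
  relative to this end, to the end \<open>5 * n' (\<sigma> i) + \<sigma> i\<close> of runner \<open>\<sigma> i\<close>.\<close>
definition runner_map :: "(int \<Rightarrow> int) \<Rightarrow> (int \<Rightarrow> int) \<Rightarrow> (int \<Rightarrow> int) \<Rightarrow> int \<Rightarrow> int" where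
  "runner_map n n' \<sigma> z = z + (5 * n' (\<sigma> (z mod 5)) + \<sigma> (z mod 5)) - (5 * n (z mod 5) + z mod 5)"

lemma runner_map_mod:
  assumes "bij_betw \<sigma> {0..<5} {0..<5}"
  shows "runner_map n n' \<sigma> z mod 5 = \<sigma> (z mod 5)"
proof -
  have "\<sigma> (z mod 5) \<in> {0..<5}" using assms by (auto simp: bij_betw_def)
  moreover have "runner_map n n' \<sigma> z = \<sigma> (z mod 5) + 5 * (z div 5 + n' (\<sigma> (z mod 5)) - n (z mod 5))"
    using div_mult_mod_eq[of z 5] by (simp add: runner_map_def algebra_simps)
  ultimately show ?thesis by (simp only: mod_mult_self2) simp
qed

lemma affine_permutation_runner_map:
  assumes \<sigma>: "bij_betw \<sigma> {0..<5} {0..<5}"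
  shows "affine_permutation 5 (runner_map n n' \<sigma>)"
proof
  show "bij (runner_map n n' \<sigma>)"
  proof (rule bijI')
    fix x y
    show "runner_map n n' \<sigma> x = runner_map n n' \<sigma> y \<longleftrightarrow> x = y"
    proof
      assume eq: "runner_map n n' \<sigma> x = runner_map n n' \<sigma> y"
      hence "\<sigma> (x mod 5) = \<sigma> (y mod 5)" by (metis runner_map_mod[OF \<sigma>])
      moreover have "x mod 5 \<in> {0..<5}" "y mod 5 \<in> {0..<5}" by auto
      ultimately have "x mod 5 = y mod 5" using \<sigma> by (metis bij_betw_def inj_onD)
      with eq show "x = y" by (simp add: runner_map_def)
    qed simp
  next
    fix z :: int
    have "z mod 5 \<in> \<sigma> ` {0..<5}" using \<sigma> by (simp add: bij_betw_def)
    then obtain i where i: "i \<in> {0..<5}" "\<sigma> i = z mod 5" by force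
    define x where "x = i + 5 * (n i - n' (\<sigma> i) + z div 5)"
    have "x mod 5 = i" using i unfolding x_def mod_mult_self2 by simp
    hence "runner_map n n' \<sigma> x = z"
      using i div_mult_mod_eq[of z 5] by (simp add: runner_map_def x_def algebra_simps)
    thus "\<exists>x. z = runner_map n n' \<sigma> x" by metis
  qed
qed (auto simp: runner_map_def)

text \<open>Each condition protects one quantity: \<open>sum0\<close> keeps the total charge 0, so
  the image is again a bead set; \<open>parity\<close> makes all displacements even and so fixes
  \<open>nvec 2\<close>; \<open>sumsq\<close> keeps the size. The equation for
  \<open>beads q\<close> serves injectivity later.\<close>

lemma transport:
  fixes n' \<sigma> :: "int \<Rightarrow> int"
  assumes p: "is_partition p" and \<sigma>: "bij_betw \<sigma> {0..<5} {0..<5}"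
    and n: "n = charge (beads p)" and n': "\<And>i. n' (i mod 5) = n' i"
    and parity: "\<And>i. i \<in> {0..<5} \<Longrightarrow> odd (n' (\<sigma> i) + \<sigma> i) \<longleftrightarrow> odd (n i + i)"
    and sum0: "(\<Sum>i\<in>{0..<5}. n' i) = 0"
    and sumsq: "(\<Sum>i\<in>{0..<5}. (5 * n' i + i)\<^sup>2) = (\<Sum>i\<in>{0..<5}. (5 * n i + i)\<^sup>2)"
  obtains q where "is_partition q" "beads q = runner_map n n' \<sigma> ` beads p"
    "charge (beads q) = n'" "sum_list q = sum_list p" "nvec 2 q 0 = nvec 2 p 0"
proof -
  define \<phi> where "\<phi> = runner_map n n' \<sigma>"
  interpret affine_permutation 5 \<phi>
    unfolding \<phi>_def by (rule affine_permutation_runner_map[OF \<sigma>])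
  define I where "I = {0..<5::int}"
  define B where "B = beads p"
  have \<sigma>I: "bij_betw \<sigma> I I" using \<sigma> by (simp add: I_def)
  have cB: "commensurable B {..<0}" by (simp add: B_def commensurable_beads)
  have \<phi>i: "\<phi> i = 5 * n' (\<sigma> i) + \<sigma> i - 5 * n i" if "i \<in> I" for i
    using that by (simp add: \<phi>_def runner_map_def I_def)
  have even_diff: "even (\<phi> x - x)" for x
    using parity[of "x mod 5"] by (auto simp: \<phi>_def runner_map_def)
  have sum_n: "sum n I = 0" using sum_charge_beads[OF p] by (simp add: n I_def)
  have "(\<Sum>i\<in>I. 5 * n' (\<sigma> i) + \<sigma> i) = (\<Sum>i\<in>I. 5 * n' i + i)"
    by (rule sum.reindex_bij_betw[OF \<sigma>I])
  hence sum_\<phi>: "(\<Sum>i\<in>I. \<phi> i) = (\<Sum>i\<in>I. i)"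
    using sum0 sum_n by (simp add: \<phi>i sum_subtractf sum.distrib sum_distrib_left[symmetric] I_def[symmetric])
  note image = excess_image_commensurable[OF cB]
  note neg = excess_image_negative[folded I_def]

  have "5 * excess (\<lambda>x. 1) (\<phi> ` {..<0}) {..<0} = (\<Sum>i\<in>I. \<phi> i - i)"
    by (rule neg) simp
  hence "excess (\<lambda>x. 1) (\<phi> ` B) {..<0} = 0"
    using excess_beads_1[OF p] image[of "\<lambda>x. 1"] by (simp add: sum_subtractf sum_\<phi> B_def o_def)
  moreover have "commensurable (\<phi> ` B) {..<0}"
    by (rule commensurable_trans[OF commensurable_image[OF bij_is_inj[OF bij] cB] commensurable_image_negative])
  ultimately obtain q where q: "is_partition q" "beads q = \<phi> ` B"
    by (metis partition_of_beads)

  have charge_I: "charge (\<phi> ` B) s = n' s" if s: "s \<in> I" for s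
  proof -
    define K where "K = (\<lambda>x::int. of_bool (x mod 5 = s) :: int)"
    have "s \<in> \<sigma> ` I" using \<sigma>I s by (simp add: bij_betw_def)
    then obtain i where i: "i \<in> I" "\<sigma> i = s" by blast
    have \<sigma>_iff: "\<sigma> j = s \<longleftrightarrow> j = i" if "j \<in> I" for j
      using \<sigma>I i that by (auto simp: bij_betw_def inj_on_def)
    have \<phi>mod: "\<phi> x mod 5 = s \<longleftrightarrow> x mod 5 = i" for x
      using \<sigma>_iff[of "x mod 5"] by (simp add: \<phi>_def runner_map_mod[OF \<sigma>] I_def)
    \<comment> \<open>The antiderivative is \<open>L x = x * K x\<close>, as \<open>K\<close> has
      period 5.\<close>
    have "5 * excess K (\<phi> ` {..<0}) {..<0} = (\<Sum>j\<in>I. \<phi> j * K (\<phi> j) - j * K j)"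
      by (rule neg) (simp add: K_def algebra_simps)
    also have "\<dots> = (\<Sum>j\<in>I. (if j = i then \<phi> j else 0) - (if j = s then j else 0))"
      by (rule sum.cong) (auto simp: K_def \<phi>mod I_def)
    also have "\<dots> = \<phi> i - s" using i s by (simp add: sum_subtractf I_def)
    finally have "5 * excess K (\<phi> ` {..<0}) {..<0} = 5 * n' s - 5 * n i"
      using i by (simp add: \<phi>i)
    moreover have "excess (K \<circ> \<phi>) B {..<0} = n i"
      using i by (simp add: K_def o_def \<phi>mod n charge_def B_def I_def)
    moreover have "charge (\<phi> ` B) s = excess K (\<phi> ` B) {..<0}"
      using s by (simp add: charge_def K_def I_def)
    ultimately show ?thesis by (simp add: image)
  qed
  have "charge (beads q) = n'"
    using charge_I[of "s mod 5" for s] n' by (simp add: fun_eq_iff q charge_mod I_def)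

  moreover have "nvec 2 q 0 = nvec 2 p 0"
  proof -
    define K where "K = (\<lambda>x::int. of_bool (x mod 2 = 0) :: int)"
    have \<phi>_odd: "odd (\<phi> x) \<longleftrightarrow> odd x" for x using even_diff[of x] by simp
    \<comment> \<open>Adding 5 flips parity, so \<open>L x = x + 5 * of_bool (odd x)\<close> grows
      by 10 at even \<open>x\<close> and by 0 at odd \<open>x\<close>.\<close>
    have "10 * excess K (\<phi> ` {..<0}) {..<0} =
        (\<Sum>i\<in>I. \<phi> i + 5 * of_bool (odd (\<phi> i)) - (i + 5 * of_bool (odd i)))"
      by (rule neg) (auto simp: K_def even_iff_mod_2_eq_zero[symmetric])
    hence "excess K (\<phi> ` {..<0}) {..<0} = 0"
      by (simp add: \<phi>_odd sum_subtractf sum_\<phi>)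
    moreover have "K \<circ> \<phi> = K"
      using \<phi>_odd by (auto simp: K_def fun_eq_iff even_iff_mod_2_eq_zero[symmetric])
    ultimately show ?thesis
      using p q by (simp add: nvec_eq_excess image B_def[symmetric] flip: K_def)
  qed

  moreover have "sum_list q = sum_list p"
  proof -
    have "excess \<phi> B {..<0} = excess (\<lambda>x. x + (\<phi> (x mod 5) - x mod 5)) B {..<0}"
      using eq_mod by (metis (no_types, lifting) ext)
    also have "\<dots> = int (sum_list p) + (\<Sum>i\<in>I. (\<phi> i - i) * n i)"
      using excess_beads_id[OF p] excess_periodic[of "\<lambda>i. \<phi> i - i"]
      by (simp add: excess_add B_def I_def n)
    finally have 1: "excess \<phi> B {..<0} = int (sum_list p) + (\<Sum>i\<in>I. (\<phi> i - i) * n i)" .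
    \<comment> \<open>\<open>L x = x\<^sup>2 - 5 * x\<close> grows by exactly \<open>10 * x\<close>
      when 5 is added.\<close>
    have 2: "10 * excess (\<lambda>x. x) (\<phi> ` {..<0}) {..<0} = (\<Sum>i\<in>I. ((\<phi> i)\<^sup>2 - 5 * \<phi> i) - (i\<^sup>2 - 5 * i))"
      by (rule neg) (simp add: power2_eq_square algebra_simps)
    have "int (sum_list q) = excess \<phi> B {..<0} + excess (\<lambda>x. x) (\<phi> ` {..<0}) {..<0}"
      using excess_beads_id[OF q(1)] image[of "\<lambda>x. x"] by (simp add: q o_def)
    hence "10 * (int (sum_list q) - int (sum_list p)) =
        10 * (\<Sum>i\<in>I. (\<phi> i - i) * n i) + (\<Sum>i\<in>I. ((\<phi> i)\<^sup>2 - 5 * \<phi> i) - (i\<^sup>2 - 5 * i))"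
      using 1 2 by simp
    \<comment> \<open>Completing the square brings in runner ends: \<open>\<phi> i + 5 * n i\<close>
      is the end of runner \<open>\<sigma> i\<close> after the move. The linear remainder sums to 0
      by \<open>sum_\<phi>\<close>.\<close>
    also have "\<dots> = (\<Sum>i\<in>I. (\<phi> i + 5 * n i)\<^sup>2 - (5 * n i + i)\<^sup>2 - 5 * (\<phi> i - i))"
      unfolding sum_distrib_left sum.distrib[symmetric]
      by (rule sum.cong) (simp_all add: power2_eq_square algebra_simps)
    also have "\<dots> = (\<Sum>i\<in>I. (\<phi> i + 5 * n i)\<^sup>2) - (\<Sum>i\<in>I. (5 * n i + i)\<^sup>2)"
      by (simp add: sum_subtractf sum_distrib_left[symmetric] sum_\<phi>)
    also have "(\<Sum>i\<in>I. (\<phi> i + 5 * n i)\<^sup>2) = (\<Sum>i\<in>I. (5 * n' (\<sigma> i) + \<sigma> i)\<^sup>2)"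
      by (rule sum.cong) (simp_all add: \<phi>i)
    also have "\<dots> = (\<Sum>i\<in>I. (5 * n' i + i)\<^sup>2)"
      by (rule sum.reindex_bij_betw[OF \<sigma>I])
    finally show ?thesis using sumsq by (simp add: I_def)
  qed
  ultimately show ?thesis using that[OF q[unfolded \<phi>_def B_def]] by blast
qed

section \<open>Garvan-Kim-Stanton coordinates for sizes congruent to 4 modulo 5\<close>

definition nvec_of :: "(int \<Rightarrow> int) \<Rightarrow> int \<Rightarrow> int" where
  "nvec_of a i = [a 0 + a 4, a 1 + a 4 - a 0, a 2 - a 1, a 3 - a 2 - a 4, - a 3 - a 4] ! nat (i mod 5)"

definition rot :: "(int \<Rightarrow> int) \<Rightarrow> int \<Rightarrow> int" where
  "rot a i = a ((i - 1) mod 5)"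

lemma atLeastLessThan_0_5: "{0..<5::int} = {0, 1, 2, 3, 4}"
  by auto

lemma nvec_of_simps:
  "nvec_of a 0 = a 0 + a 4" "nvec_of a 1 = a 1 + a 4 - a 0" "nvec_of a 2 = a 2 - a 1"
  "nvec_of a 3 = a 3 - a 2 - a 4" "nvec_of a 4 = - a 3 - a 4" "nvec_of a (i mod 5) = nvec_of a i"
  by (simp_all add: nvec_of_def numeral_eq_Suc nat_numeral)

lemma rot_simps: "rot a 0 = a 4" "rot a 1 = a 0" "rot a 2 = a 1" "rot a 3 = a 2" "rot a 4 = a 3"
  by (simp_all add: rot_def)

lemma sum_nvec_of: "(\<Sum>i\<in>{0..<5}. nvec_of a i) = 0"
  by (simp add: atLeastLessThan_0_5 nvec_of_simps)

text \<open>Once \<open>a 4 = e\<close> is chosen, \<open>n\<close> determines the other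
  coordinates, and they sum to \<open>3 * n 0 + 2 * n 1 + n 2 - n 4 - 5 * e\<close>. The congruence
  is what allows an integer \<open>e\<close> with sum 1.\<close>

lemma ex_nvec_of:
  assumes "\<And>i. n (i mod 5) = n i" "(\<Sum>i\<in>{0..<5}. n i) = 0" "(\<Sum>i\<in>{0..<5}. i * n i) mod 5 = 4"
  shows "\<exists>a. n = nvec_of a \<and> sum a {0..<5} = 1"
proof -
  have s: "n 0 + n 1 + n 2 + n 3 + n 4 = 0" using assms(2) by (simp add: atLeastLessThan_0_5)
  have "(n 1 + 2 * n 2 + 3 * n 3 + 4 * n 4) mod 5 = 4"
    using assms(3) by (simp add: atLeastLessThan_0_5 algebra_simps)
  then obtain k where "n 1 + 2 * n 2 + 3 * n 3 + 4 * n 4 = 4 + 5 * k" by (metis mod_mult_div_eq)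
  \<comment> \<open>Eliminating \<open>n 3\<close> by the zero sum turns the congruence into this
    divisibility.\<close>
  with s obtain e where e: "3 * n 0 + 2 * n 1 + n 2 - n 4 - 1 = 5 * e"
    by (intro that[of "- k - 1"]) simp
  define a where "a = (\<lambda>i::int. if i = 0 then n 0 - e else if i = 1 then n 0 + n 1 - 2 * e
      else if i = 2 then n 0 + n 1 + n 2 - 2 * e else if i = 3 then - n 4 - e else e)"
  have "n (i mod 5) = nvec_of a (i mod 5)" for i
  proof -
    have "i mod 5 \<in> {0..<5}" by simp
    hence "i mod 5 \<in> {0, 1, 2, 3, 4}" by (simp only: atLeastLessThan_0_5)
    thus ?thesis using s by (auto simp: nvec_of_simps(1-5) a_def)
  qed
  hence "n = nvec_of a" using assms(1) nvec_of_simps(6) by (metis ext)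
  moreover have "sum a {0..<5} = 1" using e by (simp add: atLeastLessThan_0_5 a_def)
  ultimately show ?thesis by blast
qed

text \<open>A vector with last coordinate \<open>d\<close> in the kernel of \<open>nvec_of\<close>
  has coordinate sum \<open>- 5 * d\<close>. Fixing the sum thus makes \<open>nvec_of\<close>
  injective, and rotation is invertible.\<close>

lemma nvec_of_rot_inject:
  assumes "nvec_of (rot a) = nvec_of (rot b)" "sum a {0..<5} = 1" "sum b {0..<5} = 1"
  shows "nvec_of a = nvec_of b"
proof -
  note eq = fun_cong[OF assms(1)]
  have "a 0 = b 0 \<and> a 1 = b 1 \<and> a 2 = b 2 \<and> a 3 = b 3 \<and> a 4 = b 4"
    using eq[of 0] eq[of 1] eq[of 2] eq[of 3] eq[of 4] assms(2,3)
    by (simp add: nvec_of_simps rot_simps atLeastLessThan_0_5)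
  thus ?thesis by (simp add: nvec_of_def fun_eq_iff)
qed

text \<open>The sum of squares is \<open>10 * s + 30\<close>, where \<open>s\<close> is the size of
  the 5-core with this n-vector; so rotation preserves that size. Eliminating \<open>a 0\<close>
  leaves a polynomial identity.\<close>

lemma sum_squares_nvec_of_rot:
  assumes "sum a {0..<5} = 1"
  shows "(\<Sum>i\<in>{0..<5}. (5 * nvec_of (rot a) i + i)\<^sup>2) = (\<Sum>i\<in>{0..<5}. (5 * nvec_of a i + i)\<^sup>2)"
proof -
  have "a 0 = 1 - a 1 - a 2 - a 3 - a 4" using assms by (simp add: atLeastLessThan_0_5)
  thus ?thesis
    by (simp add: atLeastLessThan_0_5 nvec_of_simps rot_simps) (simp add: power2_eq_square algebra_simps)
qed

text \<open>Only parities matter: all 32 patterns for \<open>a\<close> are checked, those of even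
  sum being excluded. Equal counts of odd runner ends are what a parity-preserving matching of
  runners requires.\<close>

lemma card_odd_nvec_of_rot:
  assumes "sum a {0..<5} = 1"
  shows "card {i\<in>{0..<5}. odd (nvec_of (rot a) i + i)} = card {i\<in>{0..<5}. odd (nvec_of a i + i)}"
proof -
  have "odd (sum a {0..<5})" using assms by simp
  hence "(\<Sum>i\<in>{0..<5}. of_bool (odd (nvec_of (rot a) i + i)) :: nat) = (\<Sum>i\<in>{0..<5}. of_bool (odd (nvec_of a i + i)))"
    by (cases "even (a 0)"; cases "even (a 1)"; cases "even (a 2)"; cases "even (a 3)"; cases "even (a 4)")
       (simp_all add: atLeastLessThan_0_5 nvec_of_simps rot_simps)
  thus ?thesis by (simp add: of_bool_def sum.If_cases Int_def)
qed

lemma ex_bij_betw_matching: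
  assumes "finite A" "card {i\<in>A. P i} = card {i\<in>A. Q i}"
  shows "\<exists>\<sigma>. bij_betw \<sigma> A A \<and> (\<forall>i\<in>A. Q (\<sigma> i) \<longleftrightarrow> P i)"
proof -
  have split: "A = {i\<in>A. R i} \<union> {i\<in>A. \<not> R i}" for R by auto
  have "card A = card {i\<in>A. R i} + card {i\<in>A. \<not> R i}" for R
    by (subst split[of R], rule card_Un_disjoint) (use assms in auto)
  from this[of P] this[of Q] have "card {i\<in>A. \<not> P i} = card {i\<in>A. \<not> Q i}" using assms by simp
  then obtain g where g: "bij_betw g {i\<in>A. \<not> P i} {i\<in>A. \<not> Q i}"
    using assms by (metis (no_types, lifting) finite_same_card_bij finite_Collect_conjI finite_subset mem_Collect_eq subsetI)
  obtain f where f: "bij_betw f {i\<in>A. P i} {i\<in>A. Q i}"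
    using assms by (metis (no_types, lifting) finite_same_card_bij finite_subset mem_Collect_eq subsetI)
  define \<sigma> where "\<sigma> = (\<lambda>i. if P i then f i else g i)"
  have "bij_betw \<sigma> {i\<in>A. P i} {i\<in>A. Q i}" "bij_betw \<sigma> {i\<in>A. \<not> P i} {i\<in>A. \<not> Q i}"
    by (rule bij_betw_cong[THEN iffD1, OF _ f] bij_betw_cong[THEN iffD1, OF _ g], simp add: \<sigma>_def)+
  note b = this
  have "bij_betw \<sigma> ({i\<in>A. P i} \<union> {i\<in>A. \<not> P i}) ({i\<in>A. Q i} \<union> {i\<in>A. \<not> Q i})"
    by (rule bij_betw_combine[OF b]) auto
  moreover have "\<forall>i\<in>A. Q (\<sigma> i) \<longleftrightarrow> P i"
    using b by (fastforce simp: bij_betw_def)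
  ultimately show ?thesis by (simp flip: split) blast
qed

text \<open>For coordinate sum 1 the crank is \<open>1 + a 1 + 2 * a 2 + 3 * a 3 + 4 * a 4\<close>
  modulo 5, so a cyclic shift of the indices adds the coordinate sum, which is 1.\<close>

lemma crank_nvec_of_rot:
  assumes "sum a {0..<5} = 1"
  shows "(let n = nvec_of (rot a) in 2 * (1 + n 0 - n 1 - n 2 + n 3)) mod 5 =
         ((let n = nvec_of a in 2 * (1 + n 0 - n 1 - n 2 + n 3)) mod 5 + 1) mod 5"
proof -
  define f where "f = (\<lambda>n::int \<Rightarrow> int. 2 * (1 + n 0 - n 1 - n 2 + n 3))"
  have "a 0 + a 1 + a 2 + a 3 + a 4 = 1" using assms by (simp add: atLeastLessThan_0_5)
  hence "f (nvec_of (rot a)) = f (nvec_of a) + 1 + 5 * (a 2 + a 4 - a 0 - a 1 - a 3)"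
    by (simp add: f_def nvec_of_simps rot_simps)
  hence "f (nvec_of (rot a)) mod 5 = (f (nvec_of a) mod 5 + 1) mod 5"
    by (simp only: mod_mult_self2 mod_add_left_eq)
  thus ?thesis by (simp add: f_def Let_def)
qed

section \<open>The crank-shifting injection and the equidistribution\<close>

lemma finite_partitions: "finite (partitions m)"
proof -
  have "length p \<le> sum_list p" if "0 \<notin> set p" for p :: "nat list"
    using that by (induction p) auto
  hence "partitions m \<subseteq> {p. set p \<subseteq> {..m} \<and> length p \<le> m}"
    by (auto simp: partitions_def is_partition_def member_le_sum_list)
  thus ?thesis using finite_lists_length_le[of "{..m}" m] finite_subset by blast
qed

lemma ex_inj_crank_shift:
  assumes "m mod 5 = 4"
  obtains F where "inj_on F (partitions m)"
    "\<And>p. p \<in> partitions m \<Longrightarrow>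
      F p \<in> partitions m \<and> srank (F p) mod 4 = srank p mod 4 \<and> crank5 (F p) = (crank5 p + 1) mod 5"
proof -
  define c where "c = (\<lambda>p. charge (beads p))"
  \<comment> \<open>\<open>a\<close> and \<open>\<sigma>\<close> are chosen once for each n-vector
    and not for each partition, so that partitions with equal n-vectors are moved by the same
    map.\<close>
  have "\<exists>a \<sigma>. n = nvec_of a \<and> sum a {0..<5} = 1 \<and> bij_betw \<sigma> {0..<5} {0..<5} \<and>
      (\<forall>i\<in>{0..<5}. odd (nvec_of (rot a) (\<sigma> i) + \<sigma> i) \<longleftrightarrow> odd (n i + i))"
    if n: "n \<in> c ` partitions m" for n
  proof -
    obtain p where p: "n = charge (beads p)" "is_partition p" "sum_list p = m"
      using n by (auto simp: c_def partitions_def)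
    have "int m mod 5 = 4" using assms by presburger
    then obtain a where "n = nvec_of a" "sum a {0..<5} = 1"
      using ex_nvec_of[of n] sum_charge_beads[OF p(2)] weighted_sum_charge_beads[OF p(2)] p charge_mod by auto
    thus ?thesis
      using ex_bij_betw_matching[OF _ card_odd_nvec_of_rot[symmetric], of a] by auto
  qed
  then obtain a \<sigma> where a\<sigma>: "\<And>n. n \<in> c ` partitions m \<Longrightarrow> n = nvec_of (a n) \<and> sum (a n) {0..<5} = 1 \<and>
      bij_betw (\<sigma> n) {0..<5} {0..<5} \<and>
      (\<forall>i\<in>{0..<5}. odd (nvec_of (rot (a n)) (\<sigma> n i) + \<sigma> n i) \<longleftrightarrow> odd (n i + i))"
    by metis
  define \<phi> where "\<phi> = (\<lambda>n. runner_map n (nvec_of (rot (a n))) (\<sigma> n))"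
  have "\<exists>q. is_partition q \<and> beads q = \<phi> (c p) ` beads p \<and> c q = nvec_of (rot (a (c p))) \<and>
      sum_list q = sum_list p \<and> nvec 2 q 0 = nvec 2 p 0" if "p \<in> partitions m" for p
  proof -
    define n where "n = c p"
    have n: "n = nvec_of (a n)" "sum (a n) {0..<5} = 1" "bij_betw (\<sigma> n) {0..<5} {0..<5}"
      "\<And>i. i \<in> {0..<5} \<Longrightarrow> odd (nvec_of (rot (a n)) (\<sigma> n i) + \<sigma> n i) \<longleftrightarrow> odd (n i + i)"
      using a\<sigma>[of n] that by (auto simp: n_def)
    have p: "is_partition p" using that by (simp add: partitions_def)
    have sq: "(\<Sum>i\<in>{0..<5}. (5 * nvec_of (rot (a n)) i + i)\<^sup>2) = (\<Sum>i\<in>{0..<5}. (5 * n i + i)\<^sup>2)"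
      using sum_squares_nvec_of_rot[OF n(2)] n(1) by simp
    show ?thesis
      unfolding \<phi>_def n_def[symmetric] unfolding c_def
      by (rule transport[OF p n(3) n_def[unfolded c_def] nvec_of_simps(6) n(4) sum_nvec_of sq]) blast+
  qed
  then obtain F where F: "\<And>p. p \<in> partitions m \<Longrightarrow> is_partition (F p) \<and> beads (F p) = \<phi> (c p) ` beads p \<and>
      c (F p) = nvec_of (rot (a (c p))) \<and> sum_list (F p) = sum_list p \<and> nvec 2 (F p) 0 = nvec 2 p 0"
    by metis
  have "inj_on F (partitions m)"
  proof (rule inj_onI)
    fix p q assume p: "p \<in> partitions m" and q: "q \<in> partitions m" and eq: "F p = F q"
    have ap: "c p = nvec_of (a (c p))" "sum (a (c p)) {0..<5} = 1" "bij_betw (\<sigma> (c p)) {0..<5} {0..<5}"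
      using a\<sigma>[of "c p"] p by auto
    have aq: "c q = nvec_of (a (c q))" "sum (a (c q)) {0..<5} = 1"
      using a\<sigma>[of "c q"] q by auto
    \<comment> \<open>The new n-vector determines the old one and with it the map that was applied;
      this map is injective on bead sets.\<close>
    have "nvec_of (rot (a (c p))) = nvec_of (rot (a (c q)))" using F[OF p] F[OF q] eq by simp
    hence c: "c p = c q" using nvec_of_rot_inject ap aq by metis
    interpret affine_permutation 5 "\<phi> (c p)"
      unfolding \<phi>_def by (rule affine_permutation_runner_map[OF ap(3)])
    have "\<phi> (c p) ` beads p = \<phi> (c p) ` beads q" using F[OF p] F[OF q] eq c by metis
    hence "beads p = beads q" using bij_is_inj[OF bij] by (simp add: inj_image_eq_iff)
    thus "p = q" using beads_inject p q by (simp add: partitions_def)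
  qed
  moreover have "F p \<in> partitions m \<and> srank (F p) mod 4 = srank p mod 4 \<and> crank5 (F p) = (crank5 p + 1) mod 5"
    if p: "p \<in> partitions m" for p
  proof -
    have part: "is_partition p" "is_partition (F p)" "sum_list p = m"
      using p F[OF p] by (auto simp: partitions_def)
    have a: "c p = nvec_of (a (c p))" "sum (a (c p)) {0..<5} = 1" using a\<sigma>[of "c p"] p by auto
    have "charge (beads r) = c r" for r by (simp add: c_def)
    moreover have "c (F p) = nvec_of (rot (a (c p)))" using F[OF p] by blast
    ultimately have "crank5 (F p) = (crank5 p + 1) mod 5"
      using crank_nvec_of_rot[OF a(2), folded a(1)] by (simp only: crank5_eq part)
    thus ?thesis using part F[OF p] by (simp add: partitions_def srank_mod_4)
  qed
  ultimately show ?thesis using that by blast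
qed

theorem theorem3:
  fixes n :: nat and i j :: int
  assumes "i \<in> {0, 2}" and "j \<in> {0, 1, 2, 3, 4}"
  shows "real (card {p \<in> partitions (5 * n + 4). srank p mod 4 = i \<and> crank5 p = j})
           = real (p_srank i (5 * n + 4)) / 5"
proof -
  define m where "m = 5 * n + 4"
  define C where "C = (\<lambda>j. {p \<in> partitions m. srank p mod 4 = i \<and> crank5 p = j})"
  have "m mod 5 = 4" by (simp add: m_def)
  then obtain F where inj: "inj_on F (partitions m)"
    and F: "\<And>p. p \<in> partitions m \<Longrightarrow>
      F p \<in> partitions m \<and> srank (F p) mod 4 = srank p mod 4 \<and> crank5 (F p) = (crank5 p + 1) mod 5"
    by (rule ex_inj_crank_shift) blast
  have fin: "finite (C k)" for k using finite_partitions by (simp add: C_def)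
  \<comment> \<open>\<open>F\<close> sends each crank class into the next; around the cycle of five
    classes the inequalities become equalities.\<close>
  have le: "card (C k) \<le> card (C ((k + 1) mod 5))" for k
  proof (rule card_inj_on_le)
    show "inj_on F (C k)" by (rule inj_on_subset[OF inj]) (auto simp: C_def)
    show "F ` C k \<subseteq> C ((k + 1) mod 5)" using F by (auto simp: C_def)
  qed (rule fin)
  have eq: "card (C 0) = card (C 1) \<and> card (C 1) = card (C 2) \<and> card (C 2) = card (C 3) \<and> card (C 3) = card (C 4)"
    using le[of 0] le[of 1] le[of 2] le[of 3] le[of 4] by simp
  have "crank5 p \<in> {0..<5}" for p by (simp add: crank5_def Let_def)
  hence "{p \<in> partitions m. srank p mod 4 = i} = (\<Union>k\<in>{0..<5}. C k)" by (auto simp: C_def)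
  hence "p_srank i m = (\<Sum>k\<in>{0..<5}. card (C k))"
    unfolding p_srank_def using fin by (subst card_UN_disjoint[symmetric]) (auto simp: C_def)
  also have "\<dots> = 5 * card (C j)" using eq assms(2) by (auto simp: atLeastLessThan_0_5)
  finally show ?thesis by (simp add: C_def m_def)
qed

end
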